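(* Let $T\ge 1$, let $\mathcal{K}\subseteq\mathbb{R}^n$ be a closed $\beta_K$-strongly convex set ($\beta_K>0$) with $\mathbf{0}\in\mathcal{K}$ and $\|\mathbf{x}-\mathbf{y}\|_2\le D$ for all $\mathbf{x},\mathbf{y}\in\mathcal{K}$, and let $f_1,\dots,f_T:\mathcal{K}\to\mathbb{R}$ be (differentiable) $\beta$-strongly convex functions over $\mathcal{K}$, $\beta>0$, with $\|\nabla f_t(\mathbf{x})\|_2\le G$ for all $\mathbf{x}\in\mathcal{K}$, $t\in[T]$. Let $d_1,\dots,d_T\ge 1$ be arbitrary integer delays and $d=\max\{d_1,\dots,d_T\}$. Let $\mathbf{x}_1,\dots,\mathbf{x}_T$ be the decisions played by Delayed OFW for strongly convex losses (defined in the context) run with parameter $\beta$. Then for every $\mathbf{x}^\ast\in\mathcal{K}$, $$\sum_{t=1}^T f_t(\mathbf{x}_t)-\sum_{t=1}^T f_t(\mathbf{x}^\ast)\le (C_1+C_2)\left(3dD+d\sqrt{\frac{2\gamma}{\beta}}+2\sqrt{\frac{2\gamma T}{\beta}}+\frac{2dC_1}{\beta}\ln T\right)+\gamma\sqrt{2T}+\frac{\gamma\ln T}{2}+C_1D,$$ where $\gamma=\max\left(\frac{4(G+2\beta D)^2}{\beta},\frac{288\beta}{\beta_K^2}\right)$, $C_1=G+\beta D$ and $C_2=G+2\beta D$.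
   Context: A convex set $\mathcal{K}\subseteq\mathbb{R}^n$ is $\beta_K$-strongly convex if $\gamma\mathbf{x}+(1-\gamma)\mathbf{y}+\gamma(1-\gamma)\frac{\beta_K}{2}\|\mathbf{x}-\mathbf{y}\|_2^2\,\mathbf{z}\in\mathcal{K}$ for all $\mathbf{x},\mathbf{y}\in\mathcal{K}$, $\gamma\in[0,1]$ and $\mathbf{z}\in\mathbb{R}^n$ with $\|\mathbf{z}\|_2=1$. A function $f:\mathcal{K}\to\mathbb{R}$ is $\beta$-strongly convex over $\mathcal{K}$ if $f(\mathbf{y})\ge f(\mathbf{x})+\langle\nabla f(\mathbf{x}),\mathbf{y}-\mathbf{x}\rangle+\frac{\beta}{2}\|\mathbf{y}-\mathbf{x}\|_2^2$ for all $\mathbf{x},\mathbf{y}\in\mathcal{K}$. Delayed online convex optimization: in each round $t=1,\dots,T$ the player plays $\mathbf{x}_t\in\mathcal{K}$, then the adversary selects a loss $f_t$; the gradient $\nabla f_t(\mathbf{x}_t)$ is revealed at the end of round $t+d_t-1$. Thus at the end of round $t$ the player receives $\{\nabla f_k(\mathbf{x}_k): k\in\mathcal{F}_t\}$, where $\mathcal{F}_t=\{k\in[T]: k+d_k-1=t\}$. Notation: $[T]=\{1,\dots,T\}$. Delayed OFW for strongly convex losses (input $\beta$): choose an arbitrary $\mathbf{y}_1\in\mathcal{K}$, set $\tau=1$, $\bar{\mathbf{g}}_0=\mathbf{0}$. For $t=1,\dots,T$: play $\mathbf{x}_t=\mathbf{y}_\tau$ (with the current value of $\tau$); receive $\{\nabla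 f_k(\mathbf{x}_k):k\in\mathcal{F}_t\}$; for each $k\in\mathcal{F}_t$ (processed one after another, in any order) do: (i) $\bar{\mathbf{g}}_\tau=\bar{\mathbf{g}}_{\tau-1}+\nabla f_k(\mathbf{x}_k)$ and $F_\tau(\mathbf{y})=\langle\bar{\mathbf{g}}_\tau,\mathbf{y}\rangle+\sum_{i=1}^\tau\frac{\beta}{2}\|\mathbf{y}-\mathbf{y}_i\|_2^2$; (ii) choose $\mathbf{v}_\tau\in\operatorname{argmin}_{\mathbf{y}\in\mathcal{K}}\langle\nabla F_\tau(\mathbf{y}_\tau),\mathbf{y}\rangle$; (iii) $\mathbf{y}_{\tau+1}=\mathbf{y}_\tau+\sigma_\tau(\mathbf{v}_\tau-\mathbf{y}_\tau)$, where $\sigma_\tau\in\operatorname{argmin}_{\sigma\in[0,1]}\langle\sigma(\mathbf{v}_\tau-\mathbf{y}_\tau),\nabla F_\tau(\mathbf{y}_\tau)\rangle+\frac{\beta\tau\sigma^2}{2}\|\mathbf{v}_\tau-\mathbf{y}_\tau\|_2^2$; then set $\tau\leftarrow\tau+1$. *)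

theory Defs
  imports "HOL-Analysis.Analysis"
begin

definition strongly_convex_set :: "real \<Rightarrow> 'a::euclidean_space set \<Rightarrow> bool" where
  "strongly_convex_set \<beta>K K \<longleftrightarrow>
     convex K \<and>
     (\<forall>x\<in>K. \<forall>y\<in>K. \<forall>\<gamma>\<in>{0..1}. \<forall>z. norm z = 1 \<longrightarrow>
        \<gamma> *\<^sub>R x + (1 - \<gamma>) *\<^sub>R y + (\<gamma> * (1 - \<gamma>) * (\<beta>K / 2) * (norm (x - y))\<^sup>2) *\<^sub>R z \<in> K)"

(* The losses are only given on K, so their derivative is taken relative to K; at interior points
   this is the usual gradient. *)
definition gradient_on :: "'a::euclidean_space set \<Rightarrow> ('a \<Rightarrow> real) \<Rightarrow> ('a \<Rightarrow> 'a) \<Rightarrow> bool" where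
  "gradient_on K f g \<longleftrightarrow> (\<forall>x\<in>K. (f has_derivative (\<lambda>h. g x \<bullet> h)) (at x within K))"

(* g is meant to be a gradient of f in the sense of gradient_on. *)
definition strongly_convex_fun_on ::
  "'a::euclidean_space set \<Rightarrow> real \<Rightarrow> ('a \<Rightarrow> real) \<Rightarrow> ('a \<Rightarrow> 'a) \<Rightarrow> bool" where
  "strongly_convex_fun_on K \<beta> f g \<longleftrightarrow>
     (\<forall>x\<in>K. \<forall>y\<in>K. f y \<ge> f x + g x \<bullet> (y - x) + \<beta> / 2 * (norm (y - x))\<^sup>2)"

definition received :: "nat \<Rightarrow> (nat \<Rightarrow> nat) \<Rightarrow> nat \<Rightarrow> nat set" where
  "received T d t = {k \<in> {1..T}. k + d k - 1 = t}"

definition ofw_objective ::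
  "real \<Rightarrow> (nat \<Rightarrow> 'a::euclidean_space) \<Rightarrow> (nat \<Rightarrow> 'a) \<Rightarrow> nat \<Rightarrow> 'a \<Rightarrow> real" where
  "ofw_objective \<beta> gbar y s z = gbar s \<bullet> z + (\<Sum>i = 1..s. \<beta> / 2 * (norm (z - y i))\<^sup>2)"

(* x is the sequence of decisions of some run against losses with gradients g 1, ..., g T and delays
   d 1, ..., d T. A run is described by its whole trace: tau t is the value of the counter at the
   start of round t, and c s is the round whose gradient is processed at counter value s. The
   bijection says that the gradients received in round t are processed one after another in an
   arbitrary order. gF s is the gradient of the s-th objective at y s. *)
definition delayed_ofw_sc ::
  "'a::euclidean_space set \<Rightarrow> real \<Rightarrow> nat \<Rightarrow> (nat \<Rightarrow> nat) \<Rightarrow> (nat \<Rightarrow> 'a \<Rightarrow> 'a) \<Rightarrow> (nat \<Rightarrow> 'a) \<Rightarrow> bool"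
where
  "delayed_ofw_sc K \<beta> T d g x \<longleftrightarrow>
     (\<exists>(tau :: nat \<Rightarrow> nat) (c :: nat \<Rightarrow> nat) (y :: nat \<Rightarrow> 'a) (gbar :: nat \<Rightarrow> 'a)
        (gF :: nat \<Rightarrow> 'a) (v :: nat \<Rightarrow> 'a) (\<sigma> :: nat \<Rightarrow> real).
        y 1 \<in> K \<and> tau 1 = 1 \<and> gbar 0 = 0 \<and>
        (\<forall>t\<in>{1..T}.
           x t = y (tau t) \<and>
           tau (Suc t) = tau t + card (received T d t) \<and>
           bij_betw c {tau t..<tau (Suc t)} (received T d t)) \<and>
        (\<forall>s\<in>{1..<tau (Suc T)}.
           gbar s = gbar (s - 1) + g (c s) (x (c s)) \<and>
           GDERIV (ofw_objective \<beta> gbar y s) (y s) :> gF s \<and>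
           is_arg_min (\<lambda>z. gF s \<bullet> z) (\<lambda>z. z \<in> K) (v s) \<and>
           is_arg_min
             (\<lambda>r. (r *\<^sub>R (v s - y s)) \<bullet> gF s + \<beta> * real s * r\<^sup>2 / 2 * (norm (v s - y s))\<^sup>2)
             (\<lambda>r. r \<in> {0..1}) (\<sigma> s) \<and>
           y (Suc s) = y s + \<sigma> s *\<^sub>R (v s - y s)))"

end

theory Submission
  imports Defs
begin

text \<open>
  The run is a Frank--Wolfe follow-the-leader scheme on the surrogate losses
  \<open>\<langle>p s, z\<rangle> + \<beta>/2 \<parallel>z - y s\<parallel>\<^sup>2\<close>, where \<open>p s\<close> is the \<open>s\<close>-th gradient in order of arrival. Over a
  strongly convex set one Frank--Wolfe step contracts the optimality gap fast enough to absorb the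
  next surrogate loss, so the gap stays below \<open>\<gamma>\<close> and \<open>y (s + 1)\<close> lies within \<open>sqrt (2 \<gamma> / (\<beta> s))\<close> of
  the minimiser of the first \<open>s\<close> surrogates. With be-the-leader this bounds the surrogate regret.

  The gradient \<open>p s\<close> was taken at an older iterate. Comparing both iterates with the leaders of
  their times reduces the delay error to the movement of the leaders, of order \<open>1/(\<beta> i)\<close> in step
  \<open>i\<close>; step \<open>i\<close> is charged only to the at most \<open>dmax\<close> gradients in flight at that moment.
  At most \<open>dmax\<close> gradients never arrive within \<open>T\<close> rounds; the regret of each such round is at most
  \<open>G D\<close>, and these rounds fit into the slack of the delay term.
\<close>

section \<open>Elementary sums, a limit argument and convex iterates\<close>

lemma sum_inverse_sqrt_le: "(\<Sum>k = 1..n. 1 / sqrt (real k)) \<le> 2 * sqrt (real n)"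
proof (induction n)
  case (Suc n)
  have "1 / sqrt (real (Suc n)) \<le> 2 * (sqrt (real (Suc n)) - sqrt (real n))"
  proof -
    let ?a = "sqrt (real (Suc n))" and ?b = "sqrt (real n)"
    have b: "0 \<le> ?b" "?b \<le> ?a" and a: "0 < ?a" by auto
    \<comment> \<open>Replacing \<open>?a + ?b\<close> by \<open>2 * ?a\<close> in this difference
      of squares bounds the new term by a telescoping difference.\<close>
    have "(?a - ?b) * (?a + ?b) = 1"
      by (simp add: algebra_simps flip: power2_eq_square)
    also have "\<dots> = ?a * (1 / ?a)" using a by simp
    finally have "?a * (1 / ?a) \<le> (?a - ?b) * (2 * ?a)"
      using b by (smt (verit) mult_left_mono)
    then have "?a * (1 / ?a) \<le> ?a * (2 * (?a - ?b))" by (simp only: mult_ac)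
    then show ?thesis using a by (metis mult_le_cancel_left_pos)
  qed
  with Suc show ?case by simp
qed simp

text \<open>Omitting \<open>k = 1\<close> avoids an additive constant; each use bounds its first
  term by the diameter instead.\<close>

lemma sum_inverse_le_ln: "n \<ge> 1 \<Longrightarrow> (\<Sum>k = 2..n. 1 / real k) \<le> ln (real n)"
proof (induction n rule: nat_induct_at_least)
  case (Suc n)
  have "ln (real n / real (Suc n)) \<le> real n / real (Suc n) - 1"
    using Suc by (intro ln_le_minus_one) auto
  moreover have "ln (real n / real (Suc n)) = ln (real n) - ln (real (Suc n))"
    using Suc by (simp add: ln_div)
  moreover have "real n / real (Suc n) - 1 = - (1 / real (Suc n))"
    by (simp add: field_simps)
  ultimately show ?case using Suc by (simp add: sum.nat_ivl_Suc')
qed simp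

text \<open>Yields first-order optimality from comparisons along a segment, after division by the
  step length \<open>r\<close>.\<close>

lemma nonneg_of_add_mult_nonneg:
  fixes a c :: real
  assumes "\<And>r. 0 < r \<Longrightarrow> r \<le> 1 \<Longrightarrow> 0 \<le> a + r * c"
  shows "0 \<le> a"
proof -
  have "((\<lambda>r. a + r * c) \<longlongrightarrow> a + 0 * c) (at_right 0)"
    by (intro tendsto_intros)
  moreover have "\<forall>\<^sub>F r in at_right 0. 0 \<le> a + r * c"
    by (rule eventually_mono[OF eventually_at_right_real[of 0 "1::real"]]) (auto intro: assms)
  ultimately show ?thesis
    using tendsto_lowerbound[of "\<lambda>r. a + r * c" "a + 0 * c" "at_right 0" 0] by auto
qed

text \<open>Stated outside the locales: the norm bound on gradients that \<open>ofw_run\<close>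
  assumes already needs the decisions to lie in \<open>K\<close>.\<close>

lemma convex_iterates_in:
  fixes y v :: "nat \<Rightarrow> 'a::real_vector"
  assumes "convex K" and "y 1 \<in> K"
    and "\<And>s. s \<in> {1..M} \<Longrightarrow> v s \<in> K" and "\<And>s. s \<in> {1..M} \<Longrightarrow> \<sigma> s \<in> {0..1}"
    and step: "\<And>s. s \<in> {1..M} \<Longrightarrow> y (Suc s) = y s + \<sigma> s *\<^sub>R (v s - y s)"
    and "s \<in> {1..Suc M}"
  shows "y s \<in> K"
  using assms(6)
proof (induction s)
  case (Suc s)
  show ?case
  proof (cases "s = 0")
    case False
    with Suc have s: "s \<in> {1..M}" and "y s \<in> K" by auto
    then have "(1 - \<sigma> s) *\<^sub>R y s + \<sigma> s *\<^sub>R v s \<in> K"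
      using assms(1) assms(3,4)[OF s] by (intro convexD) auto
    then show ?thesis by (simp add: step[OF s] algebra_simps)
  qed (use assms(2) in simp)
qed simp

section \<open>One Frank-Wolfe step over a strongly convex set\<close>

text \<open>The midpoint of \<open>x\<close> and \<open>v\<close>, pushed against \<open>q\<close> as far as strong convexity allows, competes with \<open>v\<close>.\<close>

lemma strongly_convex_set_linear_min:
  fixes q x v :: "'a::euclidean_space"
  assumes K: "strongly_convex_set \<beta>K K" "x \<in> K" "v \<in> K"
    and min: "\<And>z. z \<in> K \<Longrightarrow> q \<bullet> v \<le> q \<bullet> z"
  shows "q \<bullet> (v - x) \<le> - (\<beta>K / 4 * (norm (v - x))\<^sup>2 * norm q)"
proof (cases "q = 0")
  case False
  define z where "z = - (1 / norm q) *\<^sub>R q"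
  have "norm z = 1" using False by (simp add: z_def)
  have "\<forall>r\<in>{0..1}. \<forall>z. norm z = 1 \<longrightarrow>
      r *\<^sub>R x + (1 - r) *\<^sub>R v + (r * (1 - r) * (\<beta>K / 2) * (norm (x - v))\<^sup>2) *\<^sub>R z \<in> K"
    using K unfolding strongly_convex_set_def by blast
  \<comment> \<open>At the midpoint the bulge has length
    \<open>\<beta>K / 8 * (norm (x - v))\<^sup>2\<close>; solving for
    \<open>q \<bullet> (v - x)\<close> doubles the coefficient.\<close>
  from this[rule_format, OF _ \<open>norm z = 1\<close>, of "1 / 2"]
  have "(1 / 2) *\<^sub>R x + (1 - 1 / 2) *\<^sub>R v
      + (1 / 2 * (1 - 1 / 2) * (\<beta>K / 2) * (norm (x - v))\<^sup>2) *\<^sub>R z \<in> K"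
    by simp
  from min[OF this]
  have "q \<bullet> v \<le> 1/2 * (q \<bullet> x) + 1/2 * (q \<bullet> v) + (\<beta>K / 8 * (norm (v - x))\<^sup>2) * (q \<bullet> z)"
    by (simp add: inner_add_right norm_minus_commute)
  moreover have "q \<bullet> z = - norm q"
    using False by (simp add: z_def flip: power2_norm_eq_inner) (simp add: power2_eq_square)
  ultimately show ?thesis by (simp add: inner_diff_right algebra_simps)
qed simp

text \<open>Think of \<open>q\<close> as the gradient at \<open>x\<close> of a quadratic with
  Hessian \<open>L\<close> times the identity and of \<open>h\<close> as its optimality gap. Half of
  the linear decrease is kept as progress, the other half pays for the quadratic term. A large gap
  forces a large gradient, which permits a long step.\<close>

lemma frank_wolfe_step:
  fixes q x v z :: "'a::euclidean_space"
  assumes K: "strongly_convex_set \<beta>K K" "x \<in> K" "v \<in> K" "z \<in> K"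
    and min: "\<And>z. z \<in> K \<Longrightarrow> q \<bullet> v \<le> q \<bullet> z"
    and line: "\<And>r. r \<in> {0..1} \<Longrightarrow> \<sigma> * (q \<bullet> (v - x)) + L * \<sigma>\<^sup>2 / 2 * (norm (v - x))\<^sup>2
                       \<le> r * (q \<bullet> (v - x)) + L * r\<^sup>2 / 2 * (norm (v - x))\<^sup>2"
    and L: "0 < L" and \<beta>K: "0 < \<beta>K" and h: "0 \<le> h"
    and gap: "q \<bullet> (z - x) + L / 2 * (norm (z - x))\<^sup>2 \<le> - h"
  shows "h + \<sigma> * (q \<bullet> (v - x)) + L * \<sigma>\<^sup>2 / 2 * (norm (v - x))\<^sup>2
           \<le> h * max (1 / 2) (1 - \<beta>K * sqrt (2 * h / L) / 8)"
proof -
  define n where "n = norm q"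
  \<comment> \<open>The longest step in \<open>[0, 1]\<close> with
    \<open>L * r / 2 \<le> \<beta>K * n / 8\<close>, so that half of the decrease due to strong
    convexity of \<open>K\<close> covers the curvature.\<close>
  define r where "r = min 1 (\<beta>K * n / (4 * L))"
  have n: "0 \<le> n" by (simp add: n_def)
  have "2 * L * h \<le> n\<^sup>2"
  proof -
    define \<delta> where "\<delta> = norm (z - x)"
    have "- (n * \<delta>) \<le> q \<bullet> (z - x)"
      unfolding n_def \<delta>_def by (smt (verit) Cauchy_Schwarz_ineq2)
    with gap have "h \<le> n * \<delta> - L / 2 * \<delta>\<^sup>2" by (simp add: \<delta>_def)
    then have "2 * L * h \<le> 2 * L * (n * \<delta> - L / 2 * \<delta>\<^sup>2)"
      using L by (simp add: mult_left_mono)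
    \<comment> \<open>Completing the square removes the unknown distance
      \<open>\<delta>\<close>.\<close>
    also have "\<dots> = n\<^sup>2 - (n - L * \<delta>)\<^sup>2" by (simp add: power2_eq_square algebra_simps)
    finally show ?thesis by (smt (verit) zero_le_power2)
  qed
  then have "2 * h / L \<le> (n / L)\<^sup>2"
    using L by (simp add: field_simps power2_eq_square)
  then have nq: "sqrt (2 * h / L) \<le> n / L"
    using n L by (intro real_le_lsqrt) auto
  have r: "r \<in> {0..1}" using n L \<beta>K by (simp add: r_def)
  have "q \<bullet> (v - x) \<le> - h"
  proof -
    have "q \<bullet> (v - x) \<le> q \<bullet> (z - x)" using min[OF K(4)] by (simp add: inner_diff_right)
    moreover have "0 \<le> L / 2 * (norm (z - x))\<^sup>2" using L by simp
    ultimately show ?thesis using gap by linarith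
  qed
  moreover have "q \<bullet> (v - x) \<le> - (\<beta>K / 4 * (norm (v - x))\<^sup>2 * n)"
    unfolding n_def by (rule strongly_convex_set_linear_min) (use K min in auto)
  ultimately have "q \<bullet> (v - x) \<le> - h / 2 - \<beta>K / 8 * (norm (v - x))\<^sup>2 * n" by simp
  then have "r * (q \<bullet> (v - x)) \<le> r * (- h / 2 - \<beta>K / 8 * (norm (v - x))\<^sup>2 * n)"
    using r by (simp add: mult_left_mono)
  moreover have "L * r\<^sup>2 / 2 * (norm (v - x))\<^sup>2 \<le> r * (\<beta>K / 8 * (norm (v - x))\<^sup>2 * n)"
  proof -
    have "r \<le> \<beta>K * n / (4 * L)" by (simp add: r_def)
    then have "L * r / 2 \<le> \<beta>K * n / 8" using L by (simp add: field_simps)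
    then have "(L * r / 2) * (r * (norm (v - x))\<^sup>2) \<le> (\<beta>K * n / 8) * (r * (norm (v - x))\<^sup>2)"
      using r by (intro mult_right_mono) auto
    then show ?thesis by (simp add: power2_eq_square algebra_simps)
  qed
  ultimately have "r * (q \<bullet> (v - x)) + L * r\<^sup>2 / 2 * (norm (v - x))\<^sup>2 \<le> - (r * h / 2)"
    by (simp add: algebra_simps)
  with line[OF r] have "h + \<sigma> * (q \<bullet> (v - x)) + L * \<sigma>\<^sup>2 / 2 * (norm (v - x))\<^sup>2 \<le> h * (1 - r / 2)"
    by (simp add: algebra_simps)
  also have "\<dots> \<le> h * max (1 / 2) (1 - \<beta>K * sqrt (2 * h / L) / 8)"
  proof (intro mult_left_mono h)
    \<comment> \<open>A capped step \<open>r = 1\<close> gives the factor \<open>1 / 2\<close>;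
      otherwise \<open>r / 2 = \<beta>K * n / (8 * L)\<close>, and \<open>nq\<close> bounds
      \<open>n / L\<close> from below.\<close>
    have "\<beta>K * sqrt (2 * h / L) \<le> \<beta>K * (n / L)" using nq \<beta>K by (intro mult_left_mono) auto
    then show "1 - r / 2 \<le> max (1 / 2) (1 - \<beta>K * sqrt (2 * h / L) / 8)"
      by (auto simp: r_def min_def max_def)
  qed
  finally show ?thesis .
qed

text \<open>A new loss may lift the gap above \<open>\<gamma>\<close> (\<open>old\<close>), and the
  step contracts it (\<open>new\<close>). With \<open>h = \<gamma> * u\<^sup>2\<close> and
  \<open>w = 1 / sqrt s\<close>, \<open>old\<close> becomes \<open>quad\<close> and the contraction
  factor is at most \<open>max (1 / 2) (1 - 3 * (u * w))\<close>, which brings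
  \<open>u\<^sup>2\<close> back below 1.\<close>

lemma frank_wolfe_gap_invariant:
  fixes h h' G \<beta> \<beta>K \<gamma> s :: real
  assumes pos: "0 < \<beta>" "0 < \<beta>K" "0 \<le> G" "0 \<le> h" "1 \<le> s"
    and g1: "4 * G\<^sup>2 / \<beta> \<le> \<gamma>" and g2: "288 * \<beta> / \<beta>K\<^sup>2 \<le> \<gamma>"
    and old: "h \<le> \<gamma> + G * sqrt (2 * h / (\<beta> * s))"
    and new: "h' \<le> h * max (1 / 2) (1 - \<beta>K * sqrt (2 * h / (\<beta> * s)) / 8)"
  shows "h' \<le> \<gamma>"
proof -
  have "0 < 288 * \<beta> / \<beta>K\<^sup>2" using pos by simp
  with g2 have \<gamma>: "0 < \<gamma>" by linarith
  define u where "u = sqrt (h / \<gamma>)"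
  define w where "w = 1 / sqrt s"
  have u: "0 \<le> u" and hu: "h = \<gamma> * u\<^sup>2" using \<gamma> pos by (auto simp: u_def)
  have w: "0 < w" "w \<le> 1" using pos by (auto simp: w_def)
  have root: "sqrt (2 * h / (\<beta> * s)) = sqrt (2 * \<gamma> / \<beta>) * (u * w)"
    using \<gamma> pos u by (simp add: hu w_def real_sqrt_mult real_sqrt_divide)
  have "(2 * G)\<^sup>2 \<le> \<gamma> * \<beta>" using g1 pos by (simp add: field_simps)
  then have "G \<le> sqrt (\<gamma> * \<beta>) / 2" using real_le_rsqrt[of "2 * G" "\<gamma> * \<beta>"] by simp
  then have "G * sqrt (2 * \<gamma> / \<beta>) \<le> sqrt (\<gamma> * \<beta>) / 2 * sqrt (2 * \<gamma> / \<beta>)"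
    using \<gamma> pos by (intro mult_right_mono) auto
  also have "\<dots> = \<gamma> * (sqrt 2 / 2)"
    using \<gamma> pos by (simp add: real_sqrt_mult real_sqrt_divide)
  finally have "G * sqrt (2 * \<gamma> / \<beta>) * (u * w) \<le> \<gamma> * (sqrt 2 / 2) * (u * w)"
    using u w by (intro mult_right_mono) auto
  with old have "\<gamma> * u\<^sup>2 \<le> \<gamma> * (1 + sqrt 2 / 2 * (u * w))"
    unfolding root by (simp add: hu algebra_simps)
  then have quad: "u\<^sup>2 \<le> 1 + sqrt 2 / 2 * (u * w)" using \<gamma> by simp
  \<comment> \<open>The constant 288 is half of \<open>24\<^sup>2\<close>; after division by 8 the
    contraction rate is 3, which exceeds the growth rate \<open>sqrt 2 / 2\<close> in
    \<open>quad\<close>.\<close>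
  have "(24 / \<beta>K)\<^sup>2 \<le> 2 * \<gamma> / \<beta>" using g2 pos by (simp add: field_simps)
  then have "24 / \<beta>K \<le> sqrt (2 * \<gamma> / \<beta>)" by (rule real_le_rsqrt)
  then have "24 \<le> \<beta>K * sqrt (2 * \<gamma> / \<beta>)" using pos by (simp add: field_simps)
  then have "24 * (u * w) \<le> \<beta>K * sqrt (2 * \<gamma> / \<beta>) * (u * w)"
    using u w by (intro mult_right_mono) auto
  then have K: "3 * (u * w) \<le> \<beta>K * sqrt (2 * h / (\<beta> * s)) / 8" unfolding root by simp
  have "u\<^sup>2 * max (1 / 2) (1 - 3 * (u * w)) \<le> 1"
  proof -
    have "u\<^sup>2 * (1 / 2) \<le> 1"
    proof -
      \<comment> \<open>With \<open>w \<le> 1\<close>, \<open>quad\<close> becomes a quadratic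
        inequality in \<open>u\<close> whose larger root is \<open>sqrt 2\<close>, just what the
        factor \<open>1 / 2\<close> tolerates.\<close>
      have "u * w \<le> u" using u w by (simp add: mult_left_le)
      then have "sqrt 2 / 2 * (u * w) \<le> sqrt 2 / 2 * u" by (intro mult_left_mono) auto
      with quad have "u\<^sup>2 - sqrt 2 / 2 * u - 1 \<le> 0" by linarith
      moreover have "u\<^sup>2 - sqrt 2 / 2 * u - 1 = (u - sqrt 2) * (u + sqrt 2 / 2)"
      proof -
        have "(u - a) * (u + a / 2) = u\<^sup>2 - a / 2 * u - a\<^sup>2 / 2" for a :: real
          by (simp add: field_simps power2_eq_square)
        from this[of "sqrt 2"] show ?thesis by simp
      qed
      moreover have "0 < u + sqrt 2 / 2" using u by (simp add: add_nonneg_pos)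
      ultimately have "u \<le> sqrt 2" by (smt (verit) mult_pos_pos)
      then have "u\<^sup>2 \<le> (sqrt 2)\<^sup>2" using u by (intro power_mono) auto
      then show ?thesis by simp
    qed
    moreover have "u\<^sup>2 * (1 - 3 * (u * w)) \<le> 1"
    proof (cases "u\<^sup>2 \<le> 1")
      case True
      have "u\<^sup>2 * (1 - 3 * (u * w)) \<le> u\<^sup>2 * 1" using u w by (intro mult_left_mono) auto
      with True show ?thesis by simp
    next
      \<comment> \<open>For \<open>u\<^sup>2 > 1\<close> the decrease is at least
        \<open>3 * (u * w)\<close>, more than the excess over 1 that \<open>quad\<close>
        allows.\<close>
      case False
      then have "1 * (3 * (u * w)) \<le> u\<^sup>2 * (3 * (u * w))" using u w by (intro mult_right_mono) auto
      moreover have "sqrt 2 / 2 * (u * w) \<le> 3 * (u * w)"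
        using u w by (intro mult_right_mono) (auto simp: real_le_lsqrt)
      ultimately show ?thesis using quad by (simp add: algebra_simps)
    qed
    ultimately show ?thesis by (simp add: max_def)
  qed
  moreover have "h' \<le> \<gamma> * (u\<^sup>2 * max (1 / 2) (1 - 3 * (u * w)))"
  proof -
    have "h * max (1 / 2) (1 - \<beta>K * sqrt (2 * h / (\<beta> * s)) / 8) \<le> h * max (1 / 2) (1 - 3 * (u * w))"
      using K pos by (intro mult_left_mono) auto
    with new show ?thesis by (simp add: hu mult.assoc)
  qed
  ultimately show ?thesis using \<gamma> by (smt (verit) mult_left_le mult_left_mono)
qed

section \<open>Tracking the leader without delays\<close>

text \<open>Of \<open>p s\<close> only a norm bound is assumed, so it may be a gradient taken at any
  iterate, and delays stay out of this part.\<close>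

locale ofw_run =
  fixes K :: "'a::euclidean_space set"
    and \<beta> \<beta>K D G :: real
    and M :: nat
    and y p v :: "nat \<Rightarrow> 'a"
    and \<sigma> :: "nat \<Rightarrow> real"
  assumes closed: "closed K"
    and sc_set: "strongly_convex_set \<beta>K K"
    and \<beta>K: "0 < \<beta>K" and \<beta>: "0 < \<beta>"
    and diameter: "\<And>u w. u \<in> K \<Longrightarrow> w \<in> K \<Longrightarrow> norm (u - w) \<le> D"
    and start: "y 1 \<in> K"
    and norm_p: "\<And>s. s \<in> {1..M} \<Longrightarrow> norm (p s) \<le> G"
    and G: "0 \<le> G"
    and v: "\<And>s. s \<in> {1..M} \<Longrightarrow> v s \<in> K"
    and v_min: "\<And>s z. s \<in> {1..M} \<Longrightarrow> z \<in> K \<Longrightarrow>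
      (\<Sum>i = 1..s. p i + \<beta> *\<^sub>R (y s - y i)) \<bullet> v s \<le> (\<Sum>i = 1..s. p i + \<beta> *\<^sub>R (y s - y i)) \<bullet> z"
    and \<sigma>: "\<And>s. s \<in> {1..M} \<Longrightarrow> \<sigma> s \<in> {0..1}"
    and \<sigma>_min: "\<And>s r. s \<in> {1..M} \<Longrightarrow> r \<in> {0..1} \<Longrightarrow>
      \<sigma> s * ((\<Sum>i = 1..s. p i + \<beta> *\<^sub>R (y s - y i)) \<bullet> (v s - y s))
          + \<beta> * real s * (\<sigma> s)\<^sup>2 / 2 * (norm (v s - y s))\<^sup>2
        \<le> r * ((\<Sum>i = 1..s. p i + \<beta> *\<^sub>R (y s - y i)) \<bullet> (v s - y s))
          + \<beta> * real s * r\<^sup>2 / 2 * (norm (v s - y s))\<^sup>2"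
    and step: "\<And>s. s \<in> {1..M} \<Longrightarrow> y (Suc s) = y s + \<sigma> s *\<^sub>R (v s - y s)"
begin

definition loss :: "nat \<Rightarrow> 'a \<Rightarrow> real" where
  "loss s z = p s \<bullet> z + \<beta> / 2 * (norm (z - y s))\<^sup>2"

definition obj :: "nat \<Rightarrow> 'a \<Rightarrow> real" where
  "obj s z = (\<Sum>i = 1..s. loss i z)"

definition grad :: "nat \<Rightarrow> 'a \<Rightarrow> 'a" where
  "grad s z = (\<Sum>i = 1..s. p i + \<beta> *\<^sub>R (z - y i))"

text \<open>At \<open>s = 0\<close> the objective vanishes and the leader is an arbitrary point of
  \<open>K\<close>; \<open>y 1\<close> is compared with it through the diameter.\<close>

definition leader :: "nat \<Rightarrow> 'a" where
  "leader s = (SOME z. z \<in> K \<and> (\<forall>u\<in>K. obj s z \<le> obj s u))"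

definition \<gamma> :: real where
  "\<gamma> = max (4 * (G + 2 * \<beta> * D)\<^sup>2 / \<beta>) (288 * \<beta> / \<beta>K\<^sup>2)"

section \<open>Quadratic objectives and their minimisers\<close>

lemma D: "0 \<le> D"
  using diameter[OF start start] by simp

lemma obj_Suc: "obj (Suc s) z = obj s z + loss (Suc s) z"
  by (simp add: obj_def)

text \<open>A second-order Taylor expansion, exact because the objective is quadratic. It gives both
  the growth around the leader and the model of a Frank-Wolfe step.\<close>

lemma obj_expand:
  "obj s w = obj s z + grad s z \<bullet> (w - z) + \<beta> * real s / 2 * (norm (w - z))\<^sup>2"
proof -
  have "loss i w = loss i z + (p i + \<beta> *\<^sub>R (z - y i)) \<bullet> (w - z) + \<beta> / 2 * (norm (w - z))\<^sup>2" for i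
  proof -
    have "(norm (w - y i))\<^sup>2 = (norm (z - y i))\<^sup>2 + 2 * ((z - y i) \<bullet> (w - z)) + (norm (w - z))\<^sup>2"
      unfolding power2_norm_eq_inner by (simp add: algebra_simps inner_commute)
    then have "\<beta> / 2 * (norm (w - y i))\<^sup>2
        = \<beta> / 2 * (norm (z - y i))\<^sup>2 + \<beta> * ((z - y i) \<bullet> (w - z)) + \<beta> / 2 * (norm (w - z))\<^sup>2"
      by (simp add: distrib_left right_diff_distrib)
    then show ?thesis by (simp add: loss_def inner_add_left inner_diff_right right_diff_distrib)
  qed
  then have "obj s w = (\<Sum>i = 1..s. loss i z + (p i + \<beta> *\<^sub>R (z - y i)) \<bullet> (w - z) + \<beta> / 2 * (norm (w - z))\<^sup>2)"
    by (simp only: obj_def)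
  then show ?thesis
    unfolding obj_def grad_def inner_sum_left by (simp add: sum.distrib)
qed

lemma convex_K: "convex K"
  using sc_set by (simp add: strongly_convex_set_def)

lemma y_in_K: "s \<in> {1..Suc M} \<Longrightarrow> y s \<in> K"
  by (rule convex_iterates_in[OF convex_K start v \<sigma> step])

lemma leader: "leader s \<in> K" "z \<in> K \<Longrightarrow> obj s (leader s) \<le> obj s z"
proof -
  have "bounded K"
    unfolding bounded_iff
  proof (intro exI ballI)
    fix u assume "u \<in> K"
    then show "norm u \<le> D + norm (y 1)"
      using diameter[OF _ start, of u] norm_triangle_ineq2[of u "y 1"] by linarith
  qed
  with closed have "compact K" by (simp add: compact_eq_bounded_closed)
  moreover have "continuous_on K (obj s)"
    unfolding obj_def loss_def by (intro continuous_intros)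
  ultimately have "\<exists>z. z \<in> K \<and> (\<forall>u\<in>K. obj s z \<le> obj s u)"
    using continuous_attains_inf[of K "obj s"] start by blast
  then have "leader s \<in> K \<and> (\<forall>u\<in>K. obj s (leader s) \<le> obj s u)"
    unfolding leader_def by (rule someI_ex)
  then show "leader s \<in> K" "z \<in> K \<Longrightarrow> obj s (leader s) \<le> obj s z" by auto
qed

text \<open>In the expansion at the leader the linear term is nonnegative: compare with points of
  the segment towards \<open>z\<close>, divide by the step and let it shrink.\<close>

lemma leader_growth:
  assumes "z \<in> K"
  shows "\<beta> * real s / 2 * (norm (z - leader s))\<^sup>2 \<le> obj s z - obj s (leader s)"
proof -
  have "0 \<le> grad s (leader s) \<bullet> (z - leader s)"
  proof (rule nonneg_of_add_mult_nonneg)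
    fix r :: real assume r: "0 < r" "r \<le> 1"
    let ?w = "leader s + r *\<^sub>R (z - leader s)"
    have "(1 - r) *\<^sub>R leader s + r *\<^sub>R z \<in> K"
      using r leader(1) assms convex_K by (intro convexD) auto
    then have "?w \<in> K" by (simp add: algebra_simps)
    then have "obj s (leader s) \<le> obj s ?w" by (rule leader(2))
    then have "0 \<le> r * (grad s (leader s) \<bullet> (z - leader s)
        + r * (\<beta> * real s / 2 * (norm (z - leader s))\<^sup>2))"
      unfolding obj_expand[of s ?w "leader s"]
      using r by (simp add: power_mult_distrib power2_eq_square distrib_left mult_ac)
    then show "0 \<le> grad s (leader s) \<bullet> (z - leader s)
        + r * (\<beta> * real s / 2 * (norm (z - leader s))\<^sup>2)"
      using r by (simp add: zero_le_mult_iff)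
  qed
  then show ?thesis unfolding obj_expand[of s z "leader s"] by simp
qed

lemma leader_dist:
  assumes "z \<in> K" "1 \<le> s" "obj s z - obj s (leader s) \<le> e"
  shows "norm (z - leader s) \<le> sqrt (2 * e / (\<beta> * real s))"
proof -
  have "\<beta> * real s / 2 * (norm (z - leader s))\<^sup>2 \<le> e"
    using leader_growth[OF assms(1), of s] assms(3) by linarith
  then have "(norm (z - leader s))\<^sup>2 \<le> 2 * e / (\<beta> * real s)"
    using \<beta> assms(2) by (simp add: field_simps)
  then show ?thesis by (rule real_le_rsqrt)
qed

section \<open>Lipschitz estimates and stability of the leader\<close>

lemma sq_dist_diff:
  assumes "a \<in> K" "b \<in> K" "z \<in> K"
  shows "(norm (a - z))\<^sup>2 - (norm (b - z))\<^sup>2 \<le> 2 * D * norm (a - b)"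
proof -
  have D': "norm (a - z) \<le> D" "norm (b - z) \<le> D" using assms diameter by auto
  have "norm (a - z) - norm (b - z) \<le> norm (a - b)"
    using norm_triangle_ineq2[of "a - z" "b - z"] by simp
  then have "(norm (a - z) + norm (b - z)) * (norm (a - z) - norm (b - z))
      \<le> (norm (a - z) + norm (b - z)) * norm (a - b)"
    by (intro mult_left_mono) auto
  also have "\<dots> \<le> (2 * D) * norm (a - b)"
    using D' by (intro mult_right_mono) auto
  finally show ?thesis by (simp add: power2_eq_square algebra_simps)
qed

text \<open>The left side is what strong convexity at the query point \<open>a\<close> leaves of the
  regret. Replacing \<open>a\<close> by \<open>y s\<close> costs \<open>G\<close> per unit of
  distance in the linear part and \<open>\<beta> * D\<close> in the quadratic part.\<close>

lemma surrogate_bound: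
  assumes s: "s \<in> {1..M}" and "a \<in> K" "z \<in> K"
  shows "p s \<bullet> (a - z) - \<beta> / 2 * (norm (z - a))\<^sup>2
    \<le> loss s (y s) - loss s z + (G + \<beta> * D) * norm (y s - a)"
proof -
  have "y s \<in> K" using s y_in_K by simp
  have "p s \<bullet> (a - y s) \<le> norm (p s) * norm (a - y s)" by (rule norm_cauchy_schwarz)
  also have "\<dots> \<le> G * norm (y s - a)"
    unfolding norm_minus_commute[of a] using norm_p[OF s] by (intro mult_right_mono) auto
  finally have 1: "p s \<bullet> (a - y s) \<le> G * norm (y s - a)" .
  have "(norm (y s - z))\<^sup>2 - (norm (a - z))\<^sup>2 \<le> 2 * D * norm (y s - a)"
    using assms \<open>y s \<in> K\<close> by (intro sq_dist_diff)
  then have "\<beta> / 2 * ((norm (y s - z))\<^sup>2 - (norm (a - z))\<^sup>2) \<le> \<beta> / 2 * (2 * D * norm (y s - a))"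
    using \<beta> by (intro mult_left_mono) auto
  with 1 show ?thesis
    unfolding loss_def norm_minus_commute[of z] by (simp add: inner_diff_right algebra_simps)
qed

lemma loss_lipschitz:
  assumes s: "s \<in> {1..M}" and "a \<in> K" "b \<in> K"
  shows "loss s a - loss s b \<le> (G + \<beta> * D) * norm (a - b)"
proof -
  have "y s \<in> K" using s y_in_K by simp
  have "p s \<bullet> (a - b) \<le> norm (p s) * norm (a - b)" by (rule norm_cauchy_schwarz)
  also have "\<dots> \<le> G * norm (a - b)" using norm_p[OF s] by (intro mult_right_mono) auto
  finally have 1: "p s \<bullet> (a - b) \<le> G * norm (a - b)" .
  have "(norm (a - y s))\<^sup>2 - (norm (b - y s))\<^sup>2 \<le> 2 * D * norm (a - b)"
    using assms \<open>y s \<in> K\<close> by (intro sq_dist_diff)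
  then have "\<beta> / 2 * ((norm (a - y s))\<^sup>2 - (norm (b - y s))\<^sup>2) \<le> \<beta> / 2 * (2 * D * norm (a - b))"
    using \<beta> by (intro mult_left_mono) auto
  with 1 show ?thesis by (simp add: loss_def inner_diff_right algebra_simps)
qed

text \<open>\<open>leader s\<close> is optimal for all summands but the last, so the quadratic
  growth of the longer sum is paid by a single Lipschitz loss; one factor of the distance
  cancels.\<close>

lemma leader_stability:
  assumes "Suc s \<le> M"
  shows "norm (leader s - leader (Suc s)) \<le> 2 * (G + \<beta> * D) / (\<beta> * real (Suc s))"
proof -
  let ?\<delta> = "norm (leader s - leader (Suc s))"
  have "\<beta> * real (Suc s) / 2 * ?\<delta>\<^sup>2 \<le> obj (Suc s) (leader s) - obj (Suc s) (leader (Suc s))"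
    by (rule leader_growth) (rule leader)
  also have "\<dots> \<le> loss (Suc s) (leader s) - loss (Suc s) (leader (Suc s))"
    using leader(2)[OF leader(1)[of "Suc s"], of s] by (simp add: obj_Suc)
  also have "\<dots> \<le> (G + \<beta> * D) * ?\<delta>"
    using assms by (intro loss_lipschitz leader) auto
  finally have *: "?\<delta> * (\<beta> * real (Suc s) * ?\<delta>) \<le> ?\<delta> * (2 * (G + \<beta> * D))"
    by (simp add: power2_eq_square algebra_simps)
  show ?thesis
  proof (cases "?\<delta> = 0")
    case True
    then show ?thesis using G D \<beta> by simp
  next
    case False
    then have "0 < ?\<delta>" by simp
    with * have "\<beta> * real (Suc s) * ?\<delta> \<le> 2 * (G + \<beta> * D)" by (rule mult_left_le_imp_le)
    moreover have "0 < \<beta> * real (Suc s)" using \<beta> by simp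
    ultimately show ?thesis by (simp only: pos_le_divide_eq mult.commute)
  qed
qed

section \<open>Frank-Wolfe gap and distance to the leader\<close>

lemma gap_le_\<gamma>: "s \<le> M \<Longrightarrow> obj s (y (Suc s)) - obj s (leader s) \<le> \<gamma>"
proof (induction s)
  case 0
  have "0 \<le> 288 * \<beta> / \<beta>K\<^sup>2" using \<beta> by simp
  then show ?case by (simp add: obj_def \<gamma>_def le_max_iff_disj)
next
  case (Suc s)
  let ?s = "Suc s"
  have s: "?s \<in> {1..M}" and yK: "y ?s \<in> K" using Suc.prems y_in_K by auto
  define h where "h = obj ?s (y ?s) - obj ?s (leader ?s)"
  have h: "0 \<le> h" using leader(2)[OF yK] by (simp add: h_def)
  have "h \<le> (obj s (y ?s) - obj s (leader s)) + (loss ?s (y ?s) - loss ?s (leader ?s))"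
    using leader(2)[OF leader(1)[of ?s], of s] by (simp add: h_def obj_Suc)
  \<comment> \<open>The quadratic part of \<open>loss ?s\<close> vanishes at its centre
    \<open>y ?s\<close>, hence the constant \<open>G\<close> instead of
    \<open>G + \<beta> * D\<close>.\<close>
  also have "\<dots> \<le> \<gamma> + G * norm (y ?s - leader ?s)"
  proof -
    have "p ?s \<bullet> (y ?s - leader ?s) \<le> norm (p ?s) * norm (y ?s - leader ?s)"
      by (rule norm_cauchy_schwarz)
    also have "\<dots> \<le> G * norm (y ?s - leader ?s)" using norm_p[OF s] by (intro mult_right_mono) auto
    finally have "p ?s \<bullet> (y ?s - leader ?s) \<le> G * norm (y ?s - leader ?s)" .
    moreover have "0 \<le> \<beta> / 2 * (norm (leader ?s - y ?s))\<^sup>2" using \<beta> by simp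
    ultimately have "loss ?s (y ?s) - loss ?s (leader ?s) \<le> G * norm (y ?s - leader ?s)"
      by (simp add: loss_def inner_diff_right)
    with Suc show ?thesis by simp
  qed
  \<comment> \<open>The distance to the leader is bounded by the gap \<open>h\<close> itself, which
    gives a self-bounding inequality.\<close>
  also have "\<dots> \<le> \<gamma> + G * sqrt (2 * h / (\<beta> * real ?s))"
    using leader_dist[OF yK, of ?s h] G by (intro add_left_mono mult_left_mono) (auto simp: h_def)
  finally have old: "h \<le> \<gamma> + G * sqrt (2 * h / (\<beta> * real ?s))" .
  let ?q = "grad ?s (y ?s)"
  have "h + \<sigma> ?s * (?q \<bullet> (v ?s - y ?s)) + \<beta> * real ?s * (\<sigma> ?s)\<^sup>2 / 2 * (norm (v ?s - y ?s))\<^sup>2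
      \<le> h * max (1 / 2) (1 - \<beta>K * sqrt (2 * h / (\<beta> * real ?s)) / 8)"
  proof (rule frank_wolfe_step[OF sc_set yK v[OF s] leader(1)[of ?s]])
    show "?q \<bullet> v ?s \<le> ?q \<bullet> z" if "z \<in> K" for z
      using v_min[OF s that] by (simp only: grad_def)
    show "\<sigma> ?s * (?q \<bullet> (v ?s - y ?s)) + \<beta> * real ?s * (\<sigma> ?s)\<^sup>2 / 2 * (norm (v ?s - y ?s))\<^sup>2
        \<le> r * (?q \<bullet> (v ?s - y ?s)) + \<beta> * real ?s * r\<^sup>2 / 2 * (norm (v ?s - y ?s))\<^sup>2"
      if "r \<in> {0..1}" for r
      using \<sigma>_min[OF s that] by (simp only: grad_def)
    show "?q \<bullet> (leader ?s - y ?s) + \<beta> * real ?s / 2 * (norm (leader ?s - y ?s))\<^sup>2 \<le> - h"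
      unfolding h_def obj_expand[of ?s "leader ?s" "y ?s"] by simp
  qed (use \<beta> \<beta>K h in auto)
  moreover have "obj ?s (y (Suc ?s)) - obj ?s (leader ?s)
      = h + \<sigma> ?s * (?q \<bullet> (v ?s - y ?s)) + \<beta> * real ?s * (\<sigma> ?s)\<^sup>2 / 2 * (norm (v ?s - y ?s))\<^sup>2"
    using obj_expand[of ?s "y (Suc ?s)" "y ?s"] step[OF s]
    by (simp add: h_def power_mult_distrib)
  ultimately have new: "obj ?s (y (Suc ?s)) - obj ?s (leader ?s)
      \<le> h * max (1 / 2) (1 - \<beta>K * sqrt (2 * h / (\<beta> * real ?s)) / 8)" by simp
  show ?case
  proof (rule frank_wolfe_gap_invariant[OF \<beta> \<beta>K G h _ _ _ old new])
    have "G\<^sup>2 \<le> (G + 2 * \<beta> * D)\<^sup>2" using G D \<beta> by (intro power_mono) auto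
    then have "4 * G\<^sup>2 / \<beta> \<le> 4 * (G + 2 * \<beta> * D)\<^sup>2 / \<beta>"
      using \<beta> by (intro divide_right_mono mult_left_mono) auto
    then show "4 * G\<^sup>2 / \<beta> \<le> \<gamma>" by (simp add: \<gamma>_def)
  qed (auto simp: \<gamma>_def)
qed

lemma \<gamma>_pos: "0 < \<gamma>"
proof -
  have "0 < 288 * \<beta> / \<beta>K\<^sup>2" using \<beta> \<beta>K by simp
  then show ?thesis by (simp add: \<gamma>_def less_max_iff_disj)
qed

lemma tracking:
  assumes "1 \<le> s" "s \<le> M"
  shows "norm (y (Suc s) - leader s) \<le> sqrt (2 * \<gamma> / \<beta>) * (1 / sqrt (real s))"
proof -
  have "norm (y (Suc s) - leader s) \<le> sqrt (2 * \<gamma> / (\<beta> * real s))"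
    using assms by (intro leader_dist gap_le_\<gamma> y_in_K) auto
  then show ?thesis by (simp add: real_sqrt_mult real_sqrt_divide)
qed

text \<open>\<open>y s\<close> results from a step on the objective that
  \<open>leader (s - 1)\<close> minimises; the sum starts at 2 since no step precedes
  \<open>y 1\<close>.\<close>

lemma sum_tracking:
  "(\<Sum>s = 2..M. norm (y s - leader (s - 1))) \<le> 2 * sqrt (2 * \<gamma> * real M / \<beta>)"
proof -
  have "(\<Sum>s = 2..M. norm (y s - leader (s - 1))) = (\<Sum>s = 1..M - 1. norm (y (Suc s) - leader s))"
    by (intro sum.reindex_bij_witness[of _ Suc "\<lambda>s. s - 1"]) auto
  also have "\<dots> \<le> (\<Sum>s = 1..M. norm (y (Suc s) - leader s))"
    by (intro sum_mono2) auto
  also have "\<dots> \<le> (\<Sum>s = 1..M. sqrt (2 * \<gamma> / \<beta>) * (1 / sqrt (real s)))"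
    by (intro sum_mono tracking) auto
  also have "\<dots> \<le> sqrt (2 * \<gamma> / \<beta>) * (2 * sqrt (real M))"
    unfolding sum_distrib_left[symmetric]
    using sum_inverse_sqrt_le[of M] \<gamma>_pos \<beta> by (intro mult_left_mono) auto
  finally show ?thesis by (simp add: real_sqrt_mult real_sqrt_divide mult_ac)
qed

section \<open>Regret on the surrogate losses\<close>

lemma be_the_leader:
  assumes "z \<in> K"
  shows "(\<Sum>s = 1..n. loss s (leader s)) \<le> obj n z"
  using assms
proof (induction n arbitrary: z)
  case (Suc n)
  \<comment> \<open>The induction hypothesis is applied to the next leader as comparator, hence the
    generalised \<open>z\<close>.\<close>
  have "(\<Sum>s = 1..Suc n. loss s (leader s)) \<le> obj (Suc n) (leader (Suc n))"
    using Suc.IH[OF leader(1)[of "Suc n"]] by (simp add: obj_Suc)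
  also have "\<dots> \<le> obj (Suc n) z" by (rule leader(2)[OF Suc.prems])
  finally show ?case .
qed (simp add: obj_def)

text \<open>Each iterate reaches the leader of its own step via the previous leader: tracking yields
  the square root, stability the logarithm, and the first step costs the diameter.\<close>

lemma surrogate_regret:
  assumes z: "z \<in> K"
  shows "(\<Sum>s = 1..M. loss s (y s) - loss s z)
    \<le> \<gamma> * sqrt (2 * real M) + \<gamma> * ln (real M) / 2 + (G + \<beta> * D) * D"
proof (cases "M = 0")
  case True
  \<comment> \<open>By convention \<open>ln 0 = 0\<close>.\<close>
  then show ?thesis using G D \<beta> by simp
next
  case False
  let ?C = "G + \<beta> * D"
  have C: "0 \<le> ?C" using G D \<beta> by simp
  have "?C\<^sup>2 \<le> (G + 2 * \<beta> * D)\<^sup>2" using G D \<beta> by (intro power_mono) auto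
  then have "4 * ?C\<^sup>2 / \<beta> \<le> 4 * (G + 2 * \<beta> * D)\<^sup>2 / \<beta>"
    using \<beta> by (intro divide_right_mono mult_left_mono) auto
  then have C\<gamma>: "4 * ?C\<^sup>2 / \<beta> \<le> \<gamma>" by (simp add: \<gamma>_def)
  have "(2 * ?C)\<^sup>2 \<le> \<gamma> * \<beta>" using C\<gamma> \<beta> unfolding power_mult_distrib by (simp add: field_simps)
  then have C_root: "2 * ?C \<le> sqrt (\<gamma> * \<beta>)" by (rule real_le_rsqrt)
  have first: "loss 1 (y 1) - loss 1 (leader 1) \<le> ?C * D"
  proof -
    have "loss 1 (y 1) - loss 1 (leader 1) \<le> ?C * norm (y 1 - leader 1)"
      using False start leader by (intro loss_lipschitz) auto
    also have "\<dots> \<le> ?C * D" using C start leader diameter by (intro mult_left_mono) auto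
    finally show ?thesis .
  qed
  have later: "loss s (y s) - loss s (leader s)
      \<le> ?C * norm (y s - leader (s - 1)) + \<gamma> / 2 * (1 / real s)" if s: "s \<in> {2..M}" for s
  proof -
    have s': "Suc (s - 1) = s" using s by simp
    have "loss s (y s) - loss s (leader s) \<le> ?C * norm (y s - leader s)"
      using s leader y_in_K by (intro loss_lipschitz) auto
    also have "\<dots> \<le> ?C * (norm (y s - leader (s - 1)) + 2 * ?C / (\<beta> * real s))"
      using leader_stability[of "s - 1"] s C norm_triangle_ineq[of "y s - leader (s - 1)" "leader (s - 1) - leader s"]
      by (intro mult_left_mono) (simp_all add: s')
    also have "\<dots> = ?C * norm (y s - leader (s - 1)) + (4 * ?C\<^sup>2 / \<beta>) / 2 * (1 / real s)"
    proof -
      have "C * (a + 2 * C / (\<beta> * real s)) = C * a + (4 * C\<^sup>2 / \<beta>) / 2 * (1 / real s)" for C a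
        by (simp add: distrib_left power2_eq_square)
      then show ?thesis .
    qed
    also have "\<dots> \<le> ?C * norm (y s - leader (s - 1)) + \<gamma> / 2 * (1 / real s)"
      using C\<gamma> by (intro add_left_mono mult_right_mono) auto
    finally show ?thesis .
  qed
  have "(\<Sum>s = 1..M. loss s (y s) - loss s z) \<le> (\<Sum>s = 1..M. loss s (y s) - loss s (leader s))"
    using be_the_leader[OF z, of M] by (simp add: sum_subtractf obj_def)
  also have "\<dots> = (loss 1 (y 1) - loss 1 (leader 1)) + (\<Sum>s = 2..M. loss s (y s) - loss s (leader s))"
    using False by (simp add: sum.atLeast_Suc_atMost numeral_2_eq_2)
  also have "\<dots> \<le> ?C * D + (\<Sum>s = 2..M. ?C * norm (y s - leader (s - 1)) + \<gamma> / 2 * (1 / real s))"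
    by (intro add_mono first sum_mono later)
  also have "\<dots> = ?C * D + ?C * (\<Sum>s = 2..M. norm (y s - leader (s - 1)))
      + \<gamma> / 2 * (\<Sum>s = 2..M. 1 / real s)"
    by (simp only: sum.distrib sum_distrib_left[symmetric] add.assoc)
  also have "\<dots> \<le> ?C * D + \<gamma> * sqrt (2 * real M) + \<gamma> / 2 * ln (real M)"
  proof (intro add_mono order_refl)
    have "?C * (\<Sum>s = 2..M. norm (y s - leader (s - 1))) \<le> ?C * (2 * sqrt (2 * \<gamma> * real M / \<beta>))"
      by (intro mult_left_mono sum_tracking C)
    also have "\<dots> = (2 * ?C) * sqrt (2 * \<gamma> * real M / \<beta>)" by simp
    \<comment> \<open>Trading \<open>2 * ?C\<close> for \<open>sqrt (\<gamma> * \<beta>)\<close>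
      cancels \<open>\<beta>\<close> under the root.\<close>
    also have "\<dots> \<le> sqrt (\<gamma> * \<beta>) * sqrt (2 * \<gamma> * real M / \<beta>)"
      using C_root \<gamma>_pos \<beta> by (intro mult_right_mono) auto
    also have "\<dots> = \<gamma> * sqrt (2 * real M)"
      using \<gamma>_pos \<beta> by (simp add: real_sqrt_mult real_sqrt_divide)
    finally show "?C * (\<Sum>s = 2..M. norm (y s - leader (s - 1))) \<le> \<gamma> * sqrt (2 * real M)" .
    show "\<gamma> / 2 * (\<Sum>s = 2..M. 1 / real s) \<le> \<gamma> / 2 * ln (real M)"
      using False \<gamma>_pos by (intro mult_left_mono sum_inverse_le_ln) auto
  qed
  finally show ?thesis by simp
qed

lemma sum_leader_drift:
  assumes n: "M \<le> n" "1 \<le> n"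
  shows "(\<Sum>i = 1..M. norm (leader (i - 1) - leader i)) \<le> D + 2 * (G + \<beta> * D) / \<beta> * ln (real n)"
proof -
  let ?C = "G + \<beta> * D"
  have C: "0 \<le> 2 * ?C / \<beta>" using G D \<beta> by simp
  have "(\<Sum>i = 1..M. norm (leader (i - 1) - leader i))
      \<le> (\<Sum>i = 1..M. if i = 1 then D else 2 * ?C / \<beta> * (1 / real i))"
  proof (intro sum_mono)
    fix i assume "i \<in> {1..M}"
    then show "norm (leader (i - 1) - leader i) \<le> (if i = 1 then D else 2 * ?C / \<beta> * (1 / real i))"
      using leader_stability[of "i - 1"] diameter[OF leader(1) leader(1)] by auto
  qed
  \<comment> \<open>Enlarging the range keeps the first term present even for
    \<open>M = 0\<close>.\<close>
  also have "\<dots> \<le> (\<Sum>i = 1..n. if i = 1 then D else 2 * ?C / \<beta> * (1 / real i))"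
    using n D C G \<beta> by (intro sum_mono2) (auto intro!: divide_nonneg_nonneg mult_nonneg_nonneg add_nonneg_nonneg)
  also have "\<dots> = D + (\<Sum>i = 2..n. 2 * ?C / \<beta> * (1 / real i))"
    using n by (simp add: sum.atLeast_Suc_atMost numeral_2_eq_2)
  also have "\<dots> \<le> D + 2 * ?C / \<beta> * ln (real n)"
    unfolding sum_distrib_left[symmetric]
    using n C by (intro add_left_mono mult_left_mono sum_inverse_le_ln) auto
  finally show ?thesis .
qed

end

section \<open>Telescoped distances and the gradient of the objective\<close>

lemma norm_diff_le_sum_steps:
  fixes a :: "nat \<Rightarrow> 'a::real_normed_vector"
  assumes "m \<le> n"
  shows "norm (a m - a n) \<le> (\<Sum>i = m..<n. norm (a i - a (Suc i)))"
proof -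
  have "a m - a n = (\<Sum>i = m..<n. a i - a (Suc i))"
    using sum_Suc_diff'[of m n "\<lambda>i. - a i"] assms by simp
  then show ?thesis by (simp add: norm_sum)
qed

text \<open>A run only asserts that \<open>gF s\<close> is some gradient; uniqueness of the
  derivative identifies it with the explicit sum in \<open>ofw_run\<close>.\<close>

lemma ofw_objective_gradient:
  assumes "GDERIV (ofw_objective \<beta> gbar y s) z :> q"
  shows "q = gbar s + (\<Sum>i = 1..s. \<beta> *\<^sub>R (z - y i))"
proof -
  let ?q = "gbar s + (\<Sum>i = 1..s. \<beta> *\<^sub>R (z - y i))"
  have "(ofw_objective \<beta> gbar y s has_derivative (\<lambda>h. h \<bullet> ?q)) (at z)"
    unfolding ofw_objective_def power2_norm_eq_inner
    by (rule derivative_eq_intros refl | simp)+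
      (simp add: inner_add_right inner_sum_right inner_commute sum_distrib_left)
  moreover have "(ofw_objective \<beta> gbar y s has_derivative (\<lambda>h. h \<bullet> q)) (at z)"
    using assms by (simp add: gderiv_def)
  ultimately have "(\<lambda>h. h \<bullet> q) = (\<lambda>h. h \<bullet> ?q)"
    using has_derivative_unique by blast
  then have "\<forall>h. h \<bullet> q = h \<bullet> ?q" by metis
  then show ?thesis by (simp only: vector_eq_ldot)
qed

section \<open>Arrival order of delayed gradients\<close>

locale delayed_feedback =
  fixes T :: nat and d tau c :: "nat \<Rightarrow> nat"
  assumes T: "1 \<le> T"
    and d: "\<And>t. t \<in> {1..T} \<Longrightarrow> 1 \<le> d t"
    and tau_1: "tau 1 = 1"
    and tau_Suc: "\<And>t. t \<in> {1..T} \<Longrightarrow> tau (Suc t) = tau t + card (received T d t)"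
    and c: "\<And>t. t \<in> {1..T} \<Longrightarrow> bij_betw c {tau t..<tau (Suc t)} (received T d t)"
begin

definition dmax :: nat where "dmax = Max (d ` {1..T})"

definition M :: nat where "M = tau (Suc T) - 1"

text \<open>Rounds whose gradients are available before round \<open>t\<close> starts: delivery at
  the end of round \<open>k + d k - 1\<close> means \<open>k + d k - 1 < t\<close>.\<close>

definition arrived :: "nat \<Rightarrow> nat set" where
  "arrived t = {k \<in> {1..T}. k + d k \<le> t}"

lemma d_le_dmax: "t \<in> {1..T} \<Longrightarrow> d t \<le> dmax"
  by (simp add: dmax_def)

lemma dmax_pos: "1 \<le> dmax"
  using d[of 1] d_le_dmax[of 1] T by simp

lemma finite_arrived: "finite (arrived t)"
  by (simp add: arrived_def)

lemma arrived_mono: "t \<le> t' \<Longrightarrow> arrived t \<subseteq> arrived t'"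
  by (auto simp: arrived_def)

lemma arrived_Suc:
  "arrived (Suc t) = arrived t \<union> received T d t" "arrived t \<inter> received T d t = {}"
  using d by (fastforce simp: arrived_def received_def)+

text \<open>The rounds use consecutive blocks of counter values and \<open>c\<close> is a bijection
  on each, so the disjoint blocks can be glued.\<close>

lemma arrivals:
  assumes "t \<in> {1..Suc T}"
  shows "tau t = Suc (card (arrived t))" "bij_betw c {1..<tau t} (arrived t)"
proof -
  have "t \<in> {1..Suc T} \<Longrightarrow> tau t = Suc (card (arrived t)) \<and> bij_betw c {1..<tau t} (arrived t)"
  proof (induction t)
    case (Suc t)
    show ?case
    proof (cases "t = 0")
      case True
      have "arrived (Suc 0) = {}" using d by (fastforce simp: arrived_def)
      with True tau_1 show ?thesis by (simp add: bij_betw_def)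
    next
      case False
      with Suc have t: "t \<in> {1..T}"
        and IH: "tau t = Suc (card (arrived t))" "bij_betw c {1..<tau t} (arrived t)" by auto
      have "finite (received T d t)" by (simp add: received_def)
      then have "tau (Suc t) = Suc (card (arrived (Suc t)))"
        using tau_Suc[OF t] IH(1) arrived_Suc finite_arrived by (simp add: card_Un_disjoint)
      moreover have "bij_betw c ({1..<tau t} \<union> {tau t..<tau (Suc t)}) (arrived (Suc t))"
        unfolding arrived_Suc(1) by (intro bij_betw_combine IH(2) c[OF t] arrived_Suc(2))
      moreover have "{1..<tau t} \<union> {tau t..<tau (Suc t)} = {1..<tau (Suc t)}"
        using IH(1) tau_Suc[OF t] by auto
      ultimately show ?thesis by simp
    qed
  qed simp
  with assms show "tau t = Suc (card (arrived t))" "bij_betw c {1..<tau t} (arrived t)" by auto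
qed

lemma tau_pos: "t \<in> {1..Suc T} \<Longrightarrow> 1 \<le> tau t"
  by (simp add: arrivals)

lemma tau_mono: "1 \<le> t \<Longrightarrow> t \<le> t' \<Longrightarrow> t' \<le> Suc T \<Longrightarrow> tau t \<le> tau t'"
  by (simp add: arrivals card_mono finite_arrived arrived_mono)

lemma tau_end: "tau (Suc T) = Suc M"
  using tau_pos[of "Suc T"] by (simp add: M_def)

lemma bij_c: "bij_betw c {1..M} (arrived (Suc T))"
  using arrivals(2)[of "Suc T"] by (simp add: tau_end atLeastLessThanSuc_atLeastAtMost)

lemma M_le_T: "M \<le> T"
proof -
  have "card (arrived (Suc T)) \<le> card {1..T}" by (intro card_mono) (auto simp: arrived_def)
  then show ?thesis using arrivals(1)[of "Suc T"] tau_end by simp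
qed

text \<open>Every gradient queried up to round \<open>t - dmax\<close> has arrived when round
  \<open>t\<close> starts.\<close>

lemma tau_lower: "t \<in> {1..Suc T} \<Longrightarrow> t - dmax \<le> tau t - 1"
proof -
  assume t: "t \<in> {1..Suc T}"
  have "{1..t - dmax} \<subseteq> arrived t"
  proof
    fix k assume k: "k \<in> {1..t - dmax}"
    with t dmax_pos have "k \<in> {1..T}" by auto
    moreover from d_le_dmax[OF this] k have "k + d k \<le> t" by auto
    ultimately show "k \<in> arrived t" by (simp add: arrived_def)
  qed
  then have "card {1..t - dmax} \<le> card (arrived t)" by (intro card_mono finite_arrived)
  then show ?thesis using arrivals(1)[OF t] by simp
qed

lemma card_missing: "card ({1..T} - arrived (Suc T)) \<le> dmax"
proof -
  have "{1..T} - arrived (Suc T) \<subseteq> {T - dmax<..T}"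
  proof
    fix k assume "k \<in> {1..T} - arrived (Suc T)"
    then show "k \<in> {T - dmax<..T}" using d_le_dmax[of k] by (auto simp: arrived_def)
  qed
  then have "card ({1..T} - arrived (Suc T)) \<le> card {T - dmax<..T}" by (intro card_mono) auto
  then show ?thesis by simp
qed

text \<open>The blocks of counter values cover \<open>{1..M}\<close>; the block containing
  \<open>s\<close> belongs to the round in which its gradient arrives.\<close>

lemma processing_round:
  assumes "s \<in> {1..M}"
  shows "c s \<in> {1..T}" "c s + d (c s) \<le> Suc T"
    "tau (c s + d (c s) - 1) \<le> s" "s < tau (c s + d (c s))"
proof -
  have "t \<le> T \<Longrightarrow> s \<in> {1..<tau (Suc t)} \<Longrightarrow> \<exists>r\<in>{1..t}. s \<in> {tau r..<tau (Suc r)}" for t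
  proof (induction t)
    case (Suc t)
    show ?case
    proof (cases "s < tau (Suc t)")
      case True
      with Suc have "\<exists>r\<in>{1..t}. s \<in> {tau r..<tau (Suc r)}" by simp
      then show ?thesis by force
    next
      case False
      with Suc.prems show ?thesis by (intro bexI[of _ "Suc t"]) auto
    qed
  qed (use tau_1 in simp)
  from this[of T] assms obtain r where r: "r \<in> {1..T}" "s \<in> {tau r..<tau (Suc r)}"
    by (auto simp: tau_end)
  then have "c s \<in> received T d r" using c[OF r(1)] by (auto simp: bij_betw_def)
  then have cs: "c s \<in> {1..T}" "c s + d (c s) - 1 = r" by (auto simp: received_def)
  then have "Suc r = c s + d (c s)" using d[OF cs(1)] by simp
  with cs r show "c s \<in> {1..T}" "c s + d (c s) \<le> Suc T"
    "tau (c s + d (c s) - 1) \<le> s" "s < tau (c s + d (c s))" by auto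
qed

lemma tau_c_le:
  assumes "s \<in> {1..M}"
  shows "tau (c s) \<le> s"
proof -
  note r = processing_round[OF assms]
  have "tau (c s) \<le> tau (c s + d (c s) - 1)" using r(1,2) d[OF r(1)] by (intro tau_mono) auto
  with r(3) show ?thesis by simp
qed

text \<open>Each counted \<open>s\<close> processes a gradient queried before the round in which the \<open>i\<close>-th gradient
  arrives and received no earlier than in that round; this leaves \<open>dmax\<close> candidate rounds.\<close>

lemma card_in_flight:
  assumes i: "i \<in> {1..M}"
  shows "card {s \<in> {1..M}. tau (c s) \<le> i \<and> i < s} \<le> dmax"
proof -
  define t where "t = c i + d (c i) - 1"
  have t: "t \<in> {1..T}" "tau t \<le> i" "i < tau (Suc t)"
    using processing_round[OF i] d[of "c i"] by (auto simp: t_def)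
  have "c s \<in> {t - dmax<..t}" if s: "s \<in> {1..M}" "tau (c s) \<le> i" "i < s" for s
  proof -
    note r = processing_round[OF s(1)]
    have "\<not> Suc t \<le> c s"
    proof
      assume "Suc t \<le> c s"
      then have "tau (Suc t) \<le> tau (c s)" using r(1) by (intro tau_mono) auto
      with t(3) s(2) show False by simp
    qed
    moreover have "t < c s + d (c s)"
    proof (rule ccontr)
      assume "\<not> t < c s + d (c s)"
      then have "tau (c s + d (c s)) \<le> tau t" using r(1) t(1) by (intro tau_mono) auto
      with r(4) s(3) t(2) show False by simp
    qed
    ultimately show ?thesis using d_le_dmax[OF r(1)] r(1) by auto
  qed
  then have "c ` {s \<in> {1..M}. tau (c s) \<le> i \<and> i < s} \<subseteq> {t - dmax<..t}" by auto
  then have "card {s \<in> {1..M}. tau (c s) \<le> i \<and> i < s} \<le> card {t - dmax<..t}"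
    by (intro card_inj_on_le[of c] inj_on_subset[OF bij_betw_imp_inj_on[OF bij_c]]) auto
  then show ?thesis by simp
qed

text \<open>Double counting: after swapping the sums, step \<open>i\<close> is charged once per
  gradient then in flight.\<close>

lemma sum_path_length:
  fixes w :: "nat \<Rightarrow> real"
  assumes w: "\<And>i. 0 \<le> w i"
  shows "(\<Sum>s = 1..M. \<Sum>i = tau (c s)..<s. w i) \<le> real dmax * (\<Sum>i = 1..M. w i)"
proof -
  have "(\<Sum>s = 1..M. \<Sum>i = tau (c s)..<s. w i)
      = (\<Sum>s = 1..M. \<Sum>i \<in> {i \<in> {1..M}. tau (c s) \<le> i \<and> i < s}. w i)"
  proof (intro sum.cong refl)
    fix s assume s: "s \<in> {1..M}"
    then have "1 \<le> tau (c s)" using processing_round(1)[OF s] by (intro tau_pos) auto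
    with s show "{tau (c s)..<s} = {i \<in> {1..M}. tau (c s) \<le> i \<and> i < s}" by auto
  qed
  also have "\<dots> = (\<Sum>i = 1..M. \<Sum>s \<in> {s \<in> {1..M}. tau (c s) \<le> i \<and> i < s}. w i)"
    by (rule sum.swap_restrict) auto
  also have "\<dots> = (\<Sum>i = 1..M. real (card {s \<in> {1..M}. tau (c s) \<le> i \<and> i < s}) * w i)" by simp
  also have "\<dots> \<le> (\<Sum>i = 1..M. real dmax * w i)"
    using card_in_flight w by (intro sum_mono mult_right_mono) auto
  finally show ?thesis by (simp add: sum_distrib_left)
qed

end

section \<open>Regret under delays\<close>

text \<open>The number of Frank-Wolfe steps is the number of gradients processed within
  \<open>T\<close> rounds, possibly fewer than \<open>T\<close>.\<close>

locale delayed_ofw_run = delayed_feedback T d tau c + ofw_run K \<beta> \<beta>K D G "delayed_feedback.M T tau" y p v \<sigma>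
  for T :: nat and d tau c :: "nat \<Rightarrow> nat"
    and K :: "'a::euclidean_space set" and \<beta> \<beta>K D G :: real
    and y p v :: "nat \<Rightarrow> 'a" and \<sigma> :: "nat \<Rightarrow> real"
begin

text \<open>The sum runs over rounds, several of which may play the same iterate. The first
  \<open>dmax\<close> rounds pay the diameter; later at least \<open>t - dmax\<close> steps are
  complete, and a shift by \<open>dmax\<close> restores the sum of inverse roots.\<close>

lemma sum_tracking_at_query:
  "(\<Sum>t = 1..T. norm (y (tau t) - leader (tau t - 1)))
     \<le> real dmax * D + 2 * sqrt (2 * \<gamma> * real T / \<beta>)"
proof -
  let ?A = "sqrt (2 * \<gamma> / \<beta>)"
  have A: "0 \<le> ?A" using \<gamma>_pos \<beta> by simp
  have "norm (y (tau t) - leader (tau t - 1))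
      \<le> (if t \<le> dmax then D else ?A * (1 / sqrt (real (t - dmax))))" if t: "t \<in> {1..T}" for t
  proof -
    have tau: "1 \<le> tau t" "tau t \<le> Suc M"
      using t tau_pos[of t] tau_mono[of t "Suc T"] by (auto simp: tau_end)
    show ?thesis
    proof (cases "t \<le> dmax")
      case True
      then show ?thesis using tau y_in_K[of "tau t"] leader diameter by auto
    next
      case False
      have low: "t - dmax \<le> tau t - 1" using t by (intro tau_lower) auto
      have "norm (y (Suc (tau t - 1)) - leader (tau t - 1)) \<le> ?A * (1 / sqrt (real (tau t - 1)))"
        using False low tau by (intro tracking) auto
      also have "\<dots> \<le> ?A * (1 / sqrt (real (t - dmax)))"
        using False low A by (intro mult_left_mono divide_left_mono) auto
      finally show ?thesis using False tau by simp
    qed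
  qed
  then have "(\<Sum>t = 1..T. norm (y (tau t) - leader (tau t - 1)))
      \<le> (\<Sum>t = 1..T. if t \<le> dmax then D else ?A * (1 / sqrt (real (t - dmax))))"
    by (rule sum_mono)
  also have "\<dots> = (\<Sum>t \<in> {1..T} \<inter> {t. t \<le> dmax}. D)
      + (\<Sum>t \<in> {1..T} \<inter> - {t. t \<le> dmax}. ?A * (1 / sqrt (real (t - dmax))))"
    by (rule sum.If_cases) simp
  also have "(\<Sum>t \<in> {1..T} \<inter> {t. t \<le> dmax}. D) \<le> real dmax * D"
  proof -
    have "card ({1..T} \<inter> {t. t \<le> dmax}) \<le> card {1..dmax}" by (intro card_mono) auto
    then show ?thesis using D by (simp add: mult_right_mono)
  qed
  also have "(\<Sum>t \<in> {1..T} \<inter> - {t. t \<le> dmax}. ?A * (1 / sqrt (real (t - dmax))))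
      = (\<Sum>k = 1..T - dmax. ?A * (1 / sqrt (real k)))"
    by (intro sum.reindex_bij_witness[of _ "\<lambda>k. k + dmax" "\<lambda>t. t - dmax"]) auto
  also have "\<dots> \<le> ?A * (2 * sqrt (real (T - dmax)))"
    unfolding sum_distrib_left[symmetric] by (intro mult_left_mono sum_inverse_sqrt_le A)
  also have "\<dots> \<le> ?A * (2 * sqrt (real T))" by (intro mult_left_mono A) auto
  also have "\<dots> = 2 * sqrt (2 * \<gamma> * real T / \<beta>)"
    by (simp add: real_sqrt_mult real_sqrt_divide)
  finally show ?thesis by simp
qed

text \<open>The path between the two iterates runs through their leaders: two tracking errors plus
  the drift of the leaders in between.\<close>

lemma sum_delay_error:
  "(\<Sum>s = 1..M. norm (y s - y (tau (c s))))
     \<le> 3 * real dmax * D + 4 * sqrt (2 * \<gamma> * real T / \<beta>)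
        + 2 * real dmax * (G + \<beta> * D) / \<beta> * ln (real T)"
proof -
  define e where "e i = norm (y i - leader (i - 1))" for i
  define w where "w i = norm (leader (i - 1) - leader i)" for i
  have "norm (y s - y (tau (c s))) \<le> e s + e (tau (c s)) + (\<Sum>i = tau (c s)..<s. w i)"
    if s: "s \<in> {1..M}" for s
  proof -
    let ?r = "tau (c s)"
    have "norm (leader (?r - 1) - leader (s - 1)) \<le> (\<Sum>i = ?r..<s. w i)"
      using norm_diff_le_sum_steps[OF tau_c_le[OF s], of "\<lambda>i. leader (i - 1)"] by (simp add: w_def)
    moreover have "norm (y s - y ?r)
        \<le> e s + e ?r + norm (leader (?r - 1) - leader (s - 1))"
      using norm_triangle_ineq4[of "y s - leader (s - 1)" "y ?r - leader (?r - 1)"]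
        norm_triangle_ineq4[of "(y s - leader (s - 1)) - (y ?r - leader (?r - 1))" "leader (?r - 1) - leader (s - 1)"]
      by (simp add: e_def)
    ultimately show ?thesis by simp
  qed
  then have "(\<Sum>s = 1..M. norm (y s - y (tau (c s))))
      \<le> (\<Sum>s = 1..M. e s + e (tau (c s)) + (\<Sum>i = tau (c s)..<s. w i))"
    by (rule sum_mono)
  also have "\<dots> = (\<Sum>s = 1..M. e s) + (\<Sum>s = 1..M. e (tau (c s)))
      + (\<Sum>s = 1..M. \<Sum>i = tau (c s)..<s. w i)"
    by (simp only: sum.distrib)
  also have "\<dots> \<le> (real dmax * D + 2 * sqrt (2 * \<gamma> * real T / \<beta>))
      + (real dmax * D + 2 * sqrt (2 * \<gamma> * real T / \<beta>))
      + real dmax * (D + 2 * (G + \<beta> * D) / \<beta> * ln (real T))"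
  proof (intro add_mono)
    show "(\<Sum>s = 1..M. e s) \<le> real dmax * D + 2 * sqrt (2 * \<gamma> * real T / \<beta>)"
    proof (cases "M = 0")
      case True
      then show ?thesis using D \<gamma>_pos \<beta> by simp
    next
      case False
      then have "(\<Sum>s = 1..M. e s) = e 1 + (\<Sum>s = 2..M. e s)"
        by (simp add: sum.atLeast_Suc_atMost numeral_2_eq_2)
      also have "\<dots> \<le> D + 2 * sqrt (2 * \<gamma> * real M / \<beta>)"
        unfolding e_def by (intro add_mono diameter start leader sum_tracking)
      finally have "(\<Sum>s = 1..M. e s) \<le> D + 2 * sqrt (2 * \<gamma> * real M / \<beta>)" .
      moreover have "1 * D \<le> real dmax * D" using D dmax_pos by (intro mult_right_mono) auto
      moreover have "sqrt (2 * \<gamma> * real M / \<beta>) \<le> sqrt (2 * \<gamma> * real T / \<beta>)"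
        using M_le_T \<gamma>_pos \<beta> by (simp add: divide_right_mono)
      ultimately show ?thesis by linarith
    qed
    \<comment> \<open>Each round's gradient is processed at most once, so the sum passes to distinct
      rounds and can be extended to all of them.\<close>
    have "(\<Sum>s = 1..M. e (tau (c s))) = (\<Sum>t \<in> arrived (Suc T). e (tau t))"
      by (rule sum.reindex_bij_betw[OF bij_c])
    also have "\<dots> \<le> (\<Sum>t = 1..T. e (tau t))"
      by (intro sum_mono2) (auto simp: arrived_def e_def)
    also have "\<dots> \<le> real dmax * D + 2 * sqrt (2 * \<gamma> * real T / \<beta>)"
      unfolding e_def by (rule sum_tracking_at_query)
    finally show "(\<Sum>s = 1..M. e (tau (c s))) \<le> real dmax * D + 2 * sqrt (2 * \<gamma> * real T / \<beta>)" .
    have "(\<Sum>s = 1..M. \<Sum>i = tau (c s)..<s. w i) \<le> real dmax * (\<Sum>i = 1..M. w i)"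
      by (rule sum_path_length) (simp add: w_def)
    also have "\<dots> \<le> real dmax * (D + 2 * (G + \<beta> * D) / \<beta> * ln (real T))"
      unfolding w_def using M_le_T T by (intro mult_left_mono sum_leader_drift) auto
    finally show "(\<Sum>s = 1..M. \<Sum>i = tau (c s)..<s. w i)
        \<le> real dmax * (D + 2 * (G + \<beta> * D) / \<beta> * ln (real T))" .
  qed
  finally show ?thesis by (simp add: algebra_simps)
qed

text \<open>Received rounds pass to the surrogate losses at the price of the delay error; each of
  the at most \<open>dmax\<close> outstanding rounds costs \<open>G * D\<close>.\<close>

lemma sum_regret_bound:
  fixes r :: "nat \<Rightarrow> real"
  assumes z: "z \<in> K"
    and received: "\<And>s. s \<in> {1..M} \<Longrightarrow>
      r (c s) \<le> p s \<bullet> (y (tau (c s)) - z) - \<beta> / 2 * (norm (z - y (tau (c s))))\<^sup>2"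
    and missing: "\<And>t. t \<in> {1..T} \<Longrightarrow> r t \<le> G * D"
  shows "(\<Sum>t = 1..T. r t)
    \<le> ((G + \<beta> * D) + (G + 2 * \<beta> * D)) *
        (3 * real dmax * D + real dmax * sqrt (2 * \<gamma> / \<beta>) + 2 * sqrt (2 * \<gamma> * real T / \<beta>)
          + 2 * real dmax * (G + \<beta> * D) / \<beta> * ln (real T))
      + \<gamma> * sqrt (2 * real T) + \<gamma> * ln (real T) / 2 + (G + \<beta> * D) * D"
proof -
  let ?C = "G + \<beta> * D"
  let ?L = "2 * real dmax * ?C / \<beta> * ln (real T)"
  let ?S = "sqrt (2 * \<gamma> * real T / \<beta>)"
  have C: "0 \<le> ?C" using G D \<beta> by simp
  have L: "0 \<le> ?L" using C \<beta> T by simp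
  have "(\<Sum>t \<in> arrived (Suc T). r t) = (\<Sum>s = 1..M. r (c s))"
    by (rule sum.reindex_bij_betw[OF bij_c, symmetric])
  also have "\<dots> \<le> (\<Sum>s = 1..M. (loss s (y s) - loss s z) + ?C * norm (y s - y (tau (c s))))"
  proof (rule sum_mono)
    fix s assume s: "s \<in> {1..M}"
    have "tau (c s) \<in> {1..Suc M}"
      using tau_pos[of "c s"] tau_mono[of "c s" "Suc T"] processing_round(1)[OF s] by (auto simp: tau_end)
    then have "y (tau (c s)) \<in> K" by (rule y_in_K)
    from received[OF s] surrogate_bound[OF s this z]
    show "r (c s) \<le> (loss s (y s) - loss s z) + ?C * norm (y s - y (tau (c s)))" by linarith
  qed
  also have "\<dots> = (\<Sum>s = 1..M. loss s (y s) - loss s z) + ?C * (\<Sum>s = 1..M. norm (y s - y (tau (c s))))"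
    by (simp only: sum.distrib sum_distrib_left)
  also have "\<dots> \<le> (\<gamma> * sqrt (2 * real T) + \<gamma> * ln (real T) / 2 + ?C * D)
      + ?C * (3 * real dmax * D + 4 * ?S + ?L)"
  proof (intro add_mono mult_left_mono C sum_delay_error)
    have "ln (real M) \<le> ln (real T)" using M_le_T T by (cases "M = 0") auto
    then have "\<gamma> * sqrt (2 * real M) + \<gamma> * ln (real M) / 2 \<le> \<gamma> * sqrt (2 * real T) + \<gamma> * ln (real T) / 2"
      using M_le_T \<gamma>_pos by (intro add_mono divide_right_mono mult_left_mono) auto
    with surrogate_regret[OF z]
    show "(\<Sum>s = 1..M. loss s (y s) - loss s z)
        \<le> \<gamma> * sqrt (2 * real T) + \<gamma> * ln (real T) / 2 + ?C * D" by linarith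
  qed
  finally have *: "(\<Sum>t \<in> arrived (Suc T). r t)
      \<le> (\<gamma> * sqrt (2 * real T) + \<gamma> * ln (real T) / 2 + ?C * D)
        + ?C * (3 * real dmax * D + 4 * ?S + ?L)" .
  have "(\<Sum>t \<in> {1..T} - arrived (Suc T). r t) \<le> real (card ({1..T} - arrived (Suc T))) * (G * D)"
    by (rule sum_bounded_above) (use missing in auto)
  also have "\<dots> \<le> real dmax * (?C * D)"
    using card_missing G D \<beta> by (intro mult_mono mult_right_mono) auto
  finally have **: "(\<Sum>t \<in> {1..T} - arrived (Suc T). r t) \<le> ?C * (real dmax * D)" by (simp add: mult_ac)
  have "(\<Sum>t = 1..T. r t) = (\<Sum>t \<in> {1..T} - arrived (Suc T). r t) + (\<Sum>t \<in> arrived (Suc T). r t)"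
    by (rule sum.subset_diff) (auto simp: arrived_def)
  \<comment> \<open>The outstanding rounds raise 3 to 4 in front of \<open>dmax * D\<close>. Twice
    the final bracket has 6 there, and \<open>2 * ?C\<close> is at most the sum of the two
    constants.\<close>
  moreover have "?C * (3 * real dmax * D + 4 * ?S + ?L) + ?C * (real dmax * D)
      \<le> (?C + (G + 2 * \<beta> * D)) * (3 * real dmax * D + real dmax * sqrt (2 * \<gamma> / \<beta>) + 2 * ?S + ?L)"
  proof -
    have "?C * (3 * real dmax * D + 4 * ?S + ?L) + ?C * (real dmax * D)
        = ?C * (4 * (real dmax * D) + 4 * ?S + ?L)" by (simp add: algebra_simps)
    also have "\<dots> \<le> ?C * (6 * (real dmax * D) + 2 * (real dmax * sqrt (2 * \<gamma> / \<beta>)) + 4 * ?S + 2 * ?L)"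
    proof (intro mult_left_mono C)
      have arith: "4 * a + 4 * S + L \<le> 6 * a + 2 * b + 4 * S + 2 * L"
        if "0 \<le> a" "0 \<le> b" "0 \<le> L" for a b S L :: real using that by linarith
      show "4 * (real dmax * D) + 4 * ?S + ?L
          \<le> 6 * (real dmax * D) + 2 * (real dmax * sqrt (2 * \<gamma> / \<beta>)) + 4 * ?S + 2 * ?L"
        by (rule arith[OF _ _ L]) (use D \<gamma>_pos \<beta> in auto)
    qed
    also have "\<dots> = (2 * ?C) * (3 * real dmax * D + real dmax * sqrt (2 * \<gamma> / \<beta>) + 2 * ?S + ?L)"
    proof -
      have "C * (6 * (m * D) + 2 * B + 4 * S + 2 * L) = (2 * C) * (3 * m * D + B + 2 * S + L)"
        for C m D B S L :: real by (simp add: algebra_simps)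
      then show ?thesis .
    qed
    also have "\<dots> \<le> (?C + (G + 2 * \<beta> * D)) * (3 * real dmax * D + real dmax * sqrt (2 * \<gamma> / \<beta>) + 2 * ?S + ?L)"
      using L D G \<beta> \<gamma>_pos by (intro mult_right_mono add_nonneg_nonneg) auto
    finally show ?thesis .
  qed
  ultimately show ?thesis using * ** by linarith
qed

end

section \<open>Regret bound for the delayed algorithm\<close>

theorem theorem5:
  fixes K :: "'a::euclidean_space set"
    and f :: "nat \<Rightarrow> 'a \<Rightarrow> real"
    and g :: "nat \<Rightarrow> 'a \<Rightarrow> 'a"
    and d :: "nat \<Rightarrow> nat"
    and x :: "nat \<Rightarrow> 'a"
    and xstar :: 'a
    and T :: nat
    and \<beta> \<beta>K D G :: real
  assumes "T \<ge> 1"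
    and "closed K" and "\<beta>K > 0" and "strongly_convex_set \<beta>K K"
    and "0 \<in> K"
    and "\<And>u w. u \<in> K \<Longrightarrow> w \<in> K \<Longrightarrow> norm (u - w) \<le> D"
    and "\<beta> > 0"
    and "\<And>t. t \<in> {1..T} \<Longrightarrow> gradient_on K (f t) (g t)"
    and "\<And>t. t \<in> {1..T} \<Longrightarrow> strongly_convex_fun_on K \<beta> (f t) (g t)"
    and "\<And>t u. t \<in> {1..T} \<Longrightarrow> u \<in> K \<Longrightarrow> norm (g t u) \<le> G"
    and "\<And>t. t \<in> {1..T} \<Longrightarrow> d t \<ge> 1"
    and "delayed_ofw_sc K \<beta> T d g x"
    and "xstar \<in> K"
  shows
    "let dmax = real (Max (d ` {1..T}));
         \<gamma> = max (4 * (G + 2 * \<beta> * D)\<^sup>2 / \<beta>) (288 * \<beta> / \<beta>K\<^sup>2);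
         C1 = G + \<beta> * D;
         C2 = G + 2 * \<beta> * D
     in (\<Sum>t = 1..T. f t (x t)) - (\<Sum>t = 1..T. f t xstar)
          \<le> (C1 + C2) * (3 * dmax * D + dmax * sqrt (2 * \<gamma> / \<beta>) + 2 * sqrt (2 * \<gamma> * real T / \<beta>)
                          + 2 * dmax * C1 / \<beta> * ln (real T))
            + \<gamma> * sqrt (2 * real T) + \<gamma> * ln (real T) / 2 + C1 * D"
proof -
  from assms(12) obtain tau c y gbar gF v \<sigma> where
    start: "y 1 \<in> K" "tau 1 = 1" "gbar 0 = 0" and
    rounds: "\<And>t. t \<in> {1..T} \<Longrightarrow> x t = y (tau t)"
      "\<And>t. t \<in> {1..T} \<Longrightarrow> tau (Suc t) = tau t + card (received T d t)"
      "\<And>t. t \<in> {1..T} \<Longrightarrow> bij_betw c {tau t..<tau (Suc t)} (received T d t)" and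
    steps: "\<And>s. s \<in> {1..<tau (Suc T)} \<Longrightarrow> gbar s = gbar (s - 1) + g (c s) (x (c s))"
      "\<And>s. s \<in> {1..<tau (Suc T)} \<Longrightarrow> GDERIV (ofw_objective \<beta> gbar y s) (y s) :> gF s"
      "\<And>s. s \<in> {1..<tau (Suc T)} \<Longrightarrow> is_arg_min (\<lambda>z. gF s \<bullet> z) (\<lambda>z. z \<in> K) (v s)"
      "\<And>s. s \<in> {1..<tau (Suc T)} \<Longrightarrow> is_arg_min
         (\<lambda>r. (r *\<^sub>R (v s - y s)) \<bullet> gF s + \<beta> * real s * r\<^sup>2 / 2 * (norm (v s - y s))\<^sup>2)
         (\<lambda>r. r \<in> {0..1}) (\<sigma> s)"
      "\<And>s. s \<in> {1..<tau (Suc T)} \<Longrightarrow> y (Suc s) = y s + \<sigma> s *\<^sub>R (v s - y s)"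
    unfolding delayed_ofw_sc_def by blast
  interpret feedback: delayed_feedback T d tau c
    by unfold_locales (use assms start rounds in auto)
  \<comment> \<open>Gradients in order of processing, each taken at the decision of its query round
    \<open>c s\<close>.\<close>
  define p where "p s = g (c s) (x (c s))" for s
  have range: "s \<in> {1..<tau (Suc T)} \<longleftrightarrow> s \<in> {1..feedback.M}" for s
    using feedback.tau_end by auto
  note steps = steps[unfolded range]
  \<comment> \<open>The point \<open>0\<close> of \<open>K\<close> and round 1 supply a gradient
    whose norm bounds \<open>G\<close> from below.\<close>
  have G: "0 \<le> G" using assms(1) order_trans[OF norm_ge_zero assms(10)[OF _ assms(5), of 1]] by simp
  have gbar: "gbar s = (\<Sum>i = 1..s. p i)" if "s \<le> feedback.M" for s
    using that
  proof (induction s)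
    case (Suc s)
    then show ?case using steps(1)[of "Suc s"] by (simp add: p_def)
  qed (simp add: start)
  have gF: "gF s = (\<Sum>i = 1..s. p i + \<beta> *\<^sub>R (y s - y i))" if "s \<in> {1..feedback.M}" for s
    using ofw_objective_gradient[OF steps(2)[OF that]] gbar[of s] that by (simp add: sum.distrib)
  have v: "v s \<in> K" and \<sigma>: "\<sigma> s \<in> {0..1}" if "s \<in> {1..feedback.M}" for s
    using steps(3,4)[OF that] by (auto simp: is_arg_min_def)
  have "convex K" using assms(4) by (simp add: strongly_convex_set_def)
  then have y_in_K: "y s \<in> K" if "s \<in> {1..Suc feedback.M}" for s
    using start(1) v \<sigma> steps(5) that by (rule convex_iterates_in)
  have x_in_K: "x t \<in> K" if t: "t \<in> {1..T}" for t
    using rounds(1)[OF t] y_in_K[of "tau t"] t feedback.tau_pos[of t] feedback.tau_mono[of t "Suc T"]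
    by (auto simp: feedback.tau_end)
  interpret delayed_ofw_run T d tau c K \<beta> \<beta>K D G y p v \<sigma>
  proof unfold_locales
    fix s assume s: "s \<in> {1..feedback.M}"
    show "norm (p s) \<le> G"
      unfolding p_def by (intro assms x_in_K feedback.processing_round s)
    show "v s \<in> K" "\<sigma> s \<in> {0..1}" using v \<sigma> s by auto
    show "(\<Sum>i = 1..s. p i + \<beta> *\<^sub>R (y s - y i)) \<bullet> v s
        \<le> (\<Sum>i = 1..s. p i + \<beta> *\<^sub>R (y s - y i)) \<bullet> z" if "z \<in> K" for z
      using steps(3)[OF s] that unfolding gF[OF s, symmetric] is_arg_min_def by force
    show "\<sigma> s * ((\<Sum>i = 1..s. p i + \<beta> *\<^sub>R (y s - y i)) \<bullet> (v s - y s))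
          + \<beta> * real s * (\<sigma> s)\<^sup>2 / 2 * (norm (v s - y s))\<^sup>2
        \<le> r * ((\<Sum>i = 1..s. p i + \<beta> *\<^sub>R (y s - y i)) \<bullet> (v s - y s))
          + \<beta> * real s * r\<^sup>2 / 2 * (norm (v s - y s))\<^sup>2" if "r \<in> {0..1}" for r
    proof -
      have "\<not> (r *\<^sub>R (v s - y s)) \<bullet> gF s + \<beta> * real s * r\<^sup>2 / 2 * (norm (v s - y s))\<^sup>2
        < (\<sigma> s *\<^sub>R (v s - y s)) \<bullet> gF s + \<beta> * real s * (\<sigma> s)\<^sup>2 / 2 * (norm (v s - y s))\<^sup>2"
        using steps(4)[OF s] that unfolding is_arg_min_def by blast
      then show ?thesis
        unfolding gF[OF s, symmetric] inner_commute[of "gF s"] inner_scaleR_left by linarith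
    qed
    show "y (Suc s) = y s + \<sigma> s *\<^sub>R (v s - y s)" by (rule steps(5)[OF s])
  qed (use assms start G in auto)
  define r where "r t = f t (x t) - f t xstar" for t
  have linear: "r t \<le> g t (x t) \<bullet> (x t - xstar) - \<beta> / 2 * (norm (xstar - x t))\<^sup>2"
    if t: "t \<in> {1..T}" for t
  proof -
    \<comment> \<open>The quadratic term is kept: it reappears in the surrogate losses.\<close>
    have "f t (x t) + g t (x t) \<bullet> (xstar - x t) + \<beta> / 2 * (norm (xstar - x t))\<^sup>2 \<le> f t xstar"
      using assms(9)[OF t] x_in_K[OF t] assms(13) unfolding strongly_convex_fun_on_def by blast
    then show ?thesis by (simp add: r_def inner_diff_right)
  qed
  have "(\<Sum>t = 1..T. r t)
    \<le> ((G + \<beta> * D) + (G + 2 * \<beta> * D)) *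
        (3 * real feedback.dmax * D + real feedback.dmax * sqrt (2 * \<gamma> / \<beta>) + 2 * sqrt (2 * \<gamma> * real T / \<beta>)
          + 2 * real feedback.dmax * (G + \<beta> * D) / \<beta> * ln (real T))
      + \<gamma> * sqrt (2 * real T) + \<gamma> * ln (real T) / 2 + (G + \<beta> * D) * D"
  proof (rule sum_regret_bound[OF assms(13)])
    fix s assume "s \<in> {1..feedback.M}"
    then have "c s \<in> {1..T}" by (rule feedback.processing_round)
    from linear[OF this] rounds(1)[OF this]
    show "r (c s) \<le> p s \<bullet> (y (tau (c s)) - xstar) - \<beta> / 2 * (norm (xstar - y (tau (c s))))\<^sup>2"
      by (simp add: p_def)
  next
    fix t assume t: "t \<in> {1..T}"
    have "g t (x t) \<bullet> (x t - xstar) \<le> norm (g t (x t)) * norm (x t - xstar)"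
      by (rule norm_cauchy_schwarz)
    also have "\<dots> \<le> G * D" using t x_in_K[OF t] assms G by (intro mult_mono) auto
    finally have "g t (x t) \<bullet> (x t - xstar) \<le> G * D" .
    moreover have "0 \<le> \<beta> / 2 * (norm (xstar - x t))\<^sup>2" using assms(7) by simp
    ultimately show "r t \<le> G * D" using linear[OF t] by linarith
  qed
  then show ?thesis
    unfolding Let_def r_def sum_subtractf feedback.dmax_def \<gamma>_def .
qed

end
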